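(* Let $R$ be a finite commutative ring with identity and let $P$ be a proper prime ideal of $R$. Set $m=|P|$ and $q=|R/P|$. Then $q$ is a prime power and $|R|=mq$. Moreover, $$\Gamma_P(R)\cong K_{m-1}\vee \overline{K}_{m(q-1)}.$$ Equivalently, $\Gamma_P(R)\cong K_{|P|-1}\vee \overline{K}_{|P|(|R/P|-1)}$.
   Context: For a finite commutative ring $R$ with identity and a proper prime ideal $P$, the prime ideal graph $\Gamma_P(R)$ is the simple graph with vertex set $R\setminus\{0\}$ in which two distinct vertices $x,y$ are adjacent if and only if $xy\in P$. $K_a$ is the complete graph on $a$ vertices, $\overline{K}_b$ is the edgeless graph on $b$ vertices ($K_0$ is the graph with no vertices). For vertex-disjoint graphs $G,H$, the join $G\vee H$ is obtained from the disjoint union of $G$ and $H$ by adding all edges between every vertex of $G$ and every vertex of $H$. The symbol $\cong$ denotes graph isomorphism. *)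

theory Defs
  imports
    "HOL-Algebra.QuotRing"
    "HOL-Number_Theory.Prime_Powers"
    "Graph_Theory.Pair_Digraph"
    "Graph_Theory.Digraph_Isomorphism"
    "Graph_Theory.Kuratowski"
begin

text \<open>
  As usual in Graph_Theory, a finite simple graph is a finite, loop-free, symmetric digraph without
  parallel arcs (locale \<^locale>\<open>pair_graph\<close>): an edge between \<open>u\<close> and \<open>v\<close> is the pair
  of arcs \<open>(u, v)\<close> and \<open>(v, u)\<close>. For such graphs \<open>digraph_iso (with_proj G) (with_proj H)\<close> is
  ordinary graph isomorphism; see \<open>digraph_iso_with_proj_iff\<close> below.
\<close>

definition prime_ideal_graph :: "('a, 'b) ring_scheme \<Rightarrow> 'a set \<Rightarrow> 'a pair_pre_digraph" where
  "prime_ideal_graph R P =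
    \<lparr> pverts = carrier R - {\<zero>\<^bsub>R\<^esub>},
      parcs = {(x, y). x \<in> carrier R - {\<zero>\<^bsub>R\<^esub>} \<and> y \<in> carrier R - {\<zero>\<^bsub>R\<^esub>}
                 \<and> x \<noteq> y \<and> x \<otimes>\<^bsub>R\<^esub> y \<in> P} \<rparr>"

text \<open>Graph_Theory has complete graphs only as a predicate; these are representatives.\<close>

definition complete_graph :: "nat \<Rightarrow> nat pair_pre_digraph" where
  "complete_graph n =
    \<lparr> pverts = {..<n}, parcs = {(u, v). u < n \<and> v < n \<and> u \<noteq> v} \<rparr>"

definition edgeless_graph :: "nat \<Rightarrow> nat pair_pre_digraph" where
  "edgeless_graph n = \<lparr> pverts = {..<n}, parcs = {} \<rparr>"

text \<open>The sum type makes the two vertex sets disjoint.\<close>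

definition graph_join ::
  "'a pair_pre_digraph \<Rightarrow> 'b pair_pre_digraph \<Rightarrow> ('a + 'b) pair_pre_digraph" where
  "graph_join G H =
    \<lparr> pverts = pverts G <+> pverts H,
      parcs = {(Inl u, Inl v) | u v. (u, v) \<in> parcs G}
            \<union> {(Inr u, Inr v) | u v. (u, v) \<in> parcs H}
            \<union> {(Inl u, Inr v) | u v. u \<in> pverts G \<and> v \<in> pverts H}
            \<union> {(Inr v, Inl u) | u v. u \<in> pverts G \<and> v \<in> pverts H} \<rparr>"

lemma pair_graphI:
  assumes "finite (pverts G)" "parcs G \<subseteq> pverts G \<times> pverts G" "sym (parcs G)"
    "\<And>u. (u, u) \<notin> parcs G"
  shows "pair_graph G"
proof unfold_locales
  show "finite (parcs G)"
    using assms(1,2) by (meson finite_SigmaI finite_subset)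
  show "symmetric (with_proj G)"
    using assms(3) by (simp add: symmetric_def)
  show "fst e \<noteq> snd e" if "e \<in> parcs G" for e
    using assms(4)[of "fst e"] that by (metis prod.collapse)
qed (use assms in auto)

lemma pair_graph_prime_ideal_graph:
  assumes "cring R" "finite (carrier R)"
  shows "pair_graph (prime_ideal_graph R P)"
proof -
  interpret cring R by fact
  show ?thesis
    by (rule pair_graphI) (use assms(2) in \<open>auto simp: prime_ideal_graph_def sym_def m_comm\<close>)
qed

lemma complete_digraph_complete_graph: "complete_digraph n (with_proj (complete_graph n))"
  by (auto simp: complete_digraph_pair_def complete_graph_def)

lemma pair_graph_edgeless_graph: "pair_graph (edgeless_graph n)"
  by (rule pair_graphI) (auto simp: edgeless_graph_def sym_def)

lemma pair_graph_graph_join: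
  assumes "pair_graph G" "pair_graph H"
  shows "pair_graph (graph_join G H)"
proof -
  interpret G: pair_graph G by fact
  interpret H: pair_graph H by fact
  have "sym (parcs G)" "sym (parcs H)"
    using G.pair_sym_arcs H.pair_sym_arcs by (simp_all add: symmetric_def)
  then show ?thesis
    using G.pair_finite_verts H.pair_finite_verts
    by (intro pair_graphI)
      (auto simp: graph_join_def sym_def
         dest: G.in_arcsD1 G.in_arcsD2 H.in_arcsD1 H.in_arcsD2 G.pair_no_loops H.pair_no_loops)
qed

lemma digraph_iso_with_proj_iff:
  assumes "pair_wf_digraph G" "pair_wf_digraph H"
  shows "digraph_iso (with_proj G) (with_proj H) \<longleftrightarrow>
    (\<exists>f. bij_betw f (pverts G) (pverts H) \<and>
      (\<forall>u \<in> pverts G. \<forall>v \<in> pverts G. (u, v) \<in> parcs G \<longleftrightarrow> (f u, f v) \<in> parcs H))"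
    (is "?L \<longleftrightarrow> ?R")
proof
  interpret G: pair_wf_digraph G by fact
  interpret H: pair_wf_digraph H by fact
  {
    assume ?L
    then obtain h where h: "pre_digraph.digraph_isomorphism (with_proj G) h"
      and H: "with_proj H = app_iso h (with_proj G)"
      by (auto simp: digraph_iso_def)
    define f where "f = iso_verts h"
    have V: "pverts H = f ` pverts G" and A: "parcs H = iso_arcs h ` parcs G"
      and ends: "iso_tail h = fst" "iso_head h = snd"
      using arg_cong[OF H, of verts] arg_cong[OF H, of arcs]
        arg_cong[OF H, of tail] arg_cong[OF H, of head] by (auto simp: f_def)
    have inj: "inj_on f (pverts G)"
      using h by (simp add: pre_digraph.digraph_isomorphism_def f_def)
    have arc: "iso_arcs h (u, v) = (f u, f v)" if "(u, v) \<in> parcs G" for u v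
      using h that ends by (force simp: pre_digraph.digraph_isomorphism_def f_def prod_eq_iff)
    have "(u, v) \<in> parcs G \<longleftrightarrow> (f u, f v) \<in> parcs H" if uv: "u \<in> pverts G" "v \<in> pverts G" for u v
    proof
      assume "(u, v) \<in> parcs G"
      then show "(f u, f v) \<in> parcs H"
        using arc[of u v] A by (metis image_eqI)
    next
      assume "(f u, f v) \<in> parcs H"
      then obtain a b where "(a, b) \<in> parcs G" "(f u, f v) = (f a, f b)"
        using A arc by auto
      moreover from this have "a \<in> pverts G" "b \<in> pverts G"
        by (auto dest: G.in_arcsD1 G.in_arcsD2)
      ultimately show "(u, v) \<in> parcs G"
        using inj uv by (auto dest: inj_onD)
    qed
    with inj V show ?R
      by (auto simp: bij_betw_def)
  }
  {
    assume ?R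
    then obtain f where f: "bij_betw f (pverts G) (pverts H)"
      and e: "\<And>u v. u \<in> pverts G \<Longrightarrow> v \<in> pverts G \<Longrightarrow>
        (u, v) \<in> parcs G \<longleftrightarrow> (f u, f v) \<in> parcs H"
      by blast
    define h where "h = \<lparr> iso_verts = f, iso_arcs = map_prod f f, iso_head = snd, iso_tail = fst \<rparr>"
    have inj: "inj_on f (pverts G)" and V: "pverts H = f ` pverts G"
      using f by (auto simp: bij_betw_def)
    have sub: "parcs G \<subseteq> pverts G \<times> pverts G"
      by (auto dest: G.in_arcsD1 G.in_arcsD2)
    have A: "parcs H = map_prod f f ` parcs G"
    proof (intro equalityI subsetI)
      fix x assume x: "x \<in> parcs H"
      then have "fst x \<in> f ` pverts G" "snd x \<in> f ` pverts G"
        using V H.arc_fst_in_verts H.arc_snd_in_verts by auto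
      then obtain u v where "u \<in> pverts G" "v \<in> pverts G" "x = (f u, f v)"
        by (metis imageE prod.collapse)
      with e x show "x \<in> map_prod f f ` parcs G"
        by force
    qed (use e sub in auto)
    have "inj_on (map_prod f f) (parcs G)"
      using map_prod_inj_on[OF inj inj] sub by (rule inj_on_subset)
    then have "pre_digraph.digraph_isomorphism (with_proj G) h"
      using inj G.wf_digraph by (auto simp: pre_digraph.digraph_isomorphism_def h_def)
    moreover have "with_proj H = app_iso h (with_proj G)"
      using V A by (simp add: with_proj_def app_iso_def h_def)
    ultimately show ?L
      by (auto simp: digraph_iso_def)
  }
qed

end

theory Submission
  imports Defs "HOL-Algebra.Sylow" "HOL-Algebra.Multiplicative_Group"
begin

text \<open>
  Since \<open>P\<close> is a prime ideal, a product \<open>x y\<close> lies in \<open>P\<close> exactly when one of the factors does.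
  Hence two distinct nonzero elements are adjacent unless both lie outside \<open>P\<close>: the graph is
  complete on \<open>P - {0}\<close>, edgeless on \<open>R - P\<close>, and contains all edges in between
  (\<open>parcs_prime_ideal_graph\<close>). A graph with such a partition of its vertices is determined up to
  isomorphism by the sizes of the two parts (\<open>complete_join_edgeless_iso\<close>), and Lagrange's theorem
  gives \<open>|R| = m q\<close>, so that the parts have sizes \<open>m - 1\<close> and \<open>m q - m = m (q - 1)\<close>.

  That \<open>q\<close> is a prime power holds for the order of every finite integral domain
  (\<open>finite_domain_primepow_order\<close>): by Sylow's theorem each prime \<open>p\<close> dividing the order yields a
  nonzero \<open>x\<close> killed by a power \<open>p\<^sup>k\<close>; then \<open>(p\<^sup>k \<cdot> 1) x = 0\<close>, and as \<open>x\<close> can be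
  cancelled, the additive order of \<open>1\<close> divides \<open>p\<^sup>k\<close>. This order is not \<open>1\<close>, so it cannot divide
  powers of two different primes.
\<close>

text \<open>
  A Sylow \<open>p\<close>-subgroup \<open>H\<close> of the additive group has more than one element, so it contains some
  \<open>x \<noteq> 0\<close>, which is killed by \<open>|H|\<close>; cancelling \<open>x\<close> transfers this to the unit element.
\<close>

lemma (in domain) prime_power_multiple_one_eq_zero:
  assumes "finite (carrier R)" and "prime p" and "p dvd card (carrier R)"
  shows "\<exists>k. [(p ^ k :: nat)] \<cdot> \<one> = \<zero>"
proof -
  define k where "k = multiplicity p (card (carrier R))"
  have card_nz: "card (carrier R) \<noteq> 0"
    using assms(1) by auto
  have "k \<ge> 1"
    using assms card_nz unfolding k_def
    by (metis One_nat_def Suc_leI not_prime_unit prime_multiplicity_gt_zero_iff prime_imp_prime_elem)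
  obtain r where "order (add_monoid R) = p ^ k * r"
    using multiplicity_dvd[of p "card (carrier R)"] by (auto simp: k_def order_def dvd_def)
  then obtain H where H: "subgroup H (add_monoid R)" and card_H: "card H = p ^ k"
    using sylow_thm[of p "add_monoid R" k r] assms(1,2) a_group by auto
  interpret H: group "add_monoid R\<lparr>carrier := H\<rparr>"
    using H a_group by (rule subgroup.subgroup_is_group)
  have "card H > 1"
    using card_H \<open>k \<ge> 1\<close> one_less_power[OF prime_gt_1_nat[OF assms(2)], of k] by simp
  then obtain x where x: "x \<in> H" "x \<noteq> \<zero>"
    by (metis card.empty card_mono finite.emptyI finite.insertI insertCI is_singletonI'
        is_singleton_altdef less_irrefl not_less_zero subset_singletonD subsetI)
  have xR: "x \<in> carrier R"
    using H x(1) subgroup.mem_carrier by fastforce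
  have "x [^]\<^bsub>add_monoid R\<^esub> card H = \<zero>"
    using H.pow_order_eq_1[of x] x(1) by (simp add: nat_pow_def order_def)
  then have "[(p ^ k :: nat)] \<cdot> x = \<zero>"
    by (simp add: card_H add_pow_def)
  moreover have "[(p ^ k :: nat)] \<cdot> x = ([(p ^ k :: nat)] \<cdot> \<one>) \<otimes> x"
    using add_pow_ldistr[of \<one> x "p ^ k"] xR by simp
  ultimately have "[(p ^ k :: nat)] \<cdot> \<one> = \<zero>"
    using integral[of "[(p ^ k :: nat)] \<cdot> \<one>" x] x(2) xR by auto
  then show ?thesis ..
qed

lemma (in domain) finite_domain_primepow_order:
  assumes fin: "finite (carrier R)"
  shows "primepow (card (carrier R))"
proof -
  \<comment> \<open>The characteristic, as the additive order of the unit element.\<close>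
  define c where "c = group.ord (add_monoid R) \<one>"
  have c_dvd: "c dvd n \<longleftrightarrow> [n] \<cdot> \<one> = \<zero>" for n
    using group.pow_eq_id[OF a_group, of \<one> n] by (simp add: c_def add_pow_def)
  have "c \<noteq> 1"
    using c_dvd[of 1] by auto
  have unique: "p = l"
    if pl: "prime p" "prime l" "p dvd card (carrier R)" "l dvd card (carrier R)" for p l
  proof (rule ccontr)
    assume "p \<noteq> l"
    from pl obtain i j where "c dvd p ^ i" "c dvd l ^ j"
      unfolding c_dvd using prime_power_multiple_one_eq_zero[OF fin] by blast
    moreover have "coprime (p ^ i) (l ^ j)"
      using pl \<open>p \<noteq> l\<close> by (simp add: primes_coprime)
    ultimately show False
      using \<open>c \<noteq> 1\<close> by (meson coprime_common_divisor_nat)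
  qed
  have "card (carrier R) \<noteq> 0"
    using fin by auto
  have "card {\<zero>, \<one>} \<le> card (carrier R)"
    using fin by (intro card_mono) auto
  then have "card (carrier R) \<noteq> 1"
    by simp
  then obtain p where p: "prime p" "p dvd card (carrier R)"
    using prime_factor_nat by blast
  obtain r where r: "card (carrier R) = p ^ multiplicity p (card (carrier R)) * r" "\<not> p dvd r"
    using multiplicity_decompose'[of "card (carrier R)" p] p \<open>card (carrier R) \<noteq> 0\<close>
    by (metis not_prime_unit)
  have "r = 1"
  proof (rule ccontr)
    assume "r \<noteq> 1"
    then obtain l where "prime l" "l dvd r"
      using prime_factor_nat by blast
    then show False
      using unique[of p l] p r by (metis dvd_mult)
  qed
  moreover have "multiplicity p (card (carrier R)) > 0"
    using p \<open>card (carrier R) \<noteq> 0\<close> by (simp add: prime_multiplicity_gt_zero_iff)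
  ultimately show ?thesis
    using p(1) r(1) by (metis mult_1_right primepow_def)
qed

text \<open>
  Adjacency of distinct vertices depends only on whether they lie in \<open>A\<close> or \<open>B\<close>, so arbitrary
  enumerations of the two parts glue to an isomorphism.
\<close>

lemma complete_join_edgeless_iso:
  assumes G: "pair_wf_digraph G" and V: "pverts G = A \<union> B" and disj: "A \<inter> B = {}"
    and fin: "finite A" "finite B"
    and E: "parcs G = {(x, y). x \<in> A \<union> B \<and> y \<in> A \<union> B \<and> x \<noteq> y \<and> (x \<in> A \<or> y \<in> A)}"
  shows "digraph_iso (with_proj G)
    (with_proj (graph_join (complete_graph (card A)) (edgeless_graph (card B))))"
proof -
  let ?J = "graph_join (complete_graph (card A)) (edgeless_graph (card B))"
  have "pair_graph (complete_graph n)" for n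
    by (rule pair_graphI) (auto simp: complete_graph_def sym_def)
  then interpret J: pair_graph ?J
    using pair_graph_edgeless_graph by (rule pair_graph_graph_join)
  obtain f g where f: "bij_betw f A {..<card A}" and g: "bij_betw g B {..<card B}"
    using ex_bij_betw_finite_nat[OF fin(1)] ex_bij_betw_finite_nat[OF fin(2)]
    by (auto simp: atLeast0LessThan)
  define h where "h x = (if x \<in> A then Inl (f x) else Inr (g x))" for x
  have lt: "x \<in> A \<Longrightarrow> f x < card A" "x \<in> B \<Longrightarrow> g x < card B" for x
    using f g by (auto simp: bij_betw_def)
  have h: "x \<in> A \<Longrightarrow> h x = Inl (f x)" "x \<in> B \<Longrightarrow> h x = Inr (g x)" for x
    using disj by (auto simp: h_def)
  have "bij_betw h A (Inl ` {..<card A})" "bij_betw h B (Inr ` {..<card B})"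
    using f g h by (auto simp: bij_betw_def inj_on_def image_image cong: image_cong)
  then have "bij_betw h (A \<union> B) (Inl ` {..<card A} \<union> Inr ` {..<card B})"
    by (rule bij_betw_combine) auto
  then have "bij_betw h (pverts G) (pverts ?J)"
    by (simp add: V graph_join_def complete_graph_def edgeless_graph_def Plus_def)
  moreover have "(u, v) \<in> parcs G \<longleftrightarrow> (h u, h v) \<in> parcs ?J"
    if "u \<in> pverts G" "v \<in> pverts G" for u v
  proof -
    have "f u = f v \<longleftrightarrow> u = v" if "u \<in> A" "v \<in> A"
      using f that by (auto simp: bij_betw_def inj_on_def)
    then show ?thesis
      using that disj h lt unfolding V E
      by (auto simp: graph_join_def complete_graph_def edgeless_graph_def)
  qed
  ultimately show ?thesis
    using digraph_iso_with_proj_iff[OF G J.pair_wf_digraph_axioms] by blast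
qed

lemma (in primeideal) parcs_prime_ideal_graph:
  "parcs (prime_ideal_graph R I) =
    {(x, y). x \<in> carrier R - {\<zero>} \<and> y \<in> carrier R - {\<zero>} \<and> x \<noteq> y \<and> (x \<in> I \<or> y \<in> I)}"
  using I_prime by (auto simp: prime_ideal_graph_def I_l_closed I_r_closed)

lemma (in ideal) card_carrier_eq_card_ideal_times_card_quotient:
  assumes "finite (carrier R)"
  shows "card (carrier R) = card I * card (carrier (R Quot I))"
  using a_lagrange[OF assms additive_subgroup_axioms]
  by (simp add: FactRing_def order_def mult.commute)

theorem proposition2p1:
  fixes R :: "('a, 'b) ring_scheme" and P :: "'a set" and m q :: nat
  assumes "cring R" and "finite (carrier R)" and "primeideal P R"
    and "m = card P" and "q = card (carrier (R Quot P))"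
  shows "primepow q \<and> card (carrier R) = m * q
    \<and> digraph_iso (with_proj (prime_ideal_graph R P))
        (with_proj (graph_join (complete_graph (m - 1)) (edgeless_graph (m * (q - 1)))))
    \<and> digraph_iso (with_proj (prime_ideal_graph R P))
        (with_proj (graph_join (complete_graph (card P - 1))
          (edgeless_graph (card P * (card (carrier (R Quot P)) - 1)))))"
proof -
  interpret primeideal P R by fact
  interpret \<Gamma>: pair_graph "prime_ideal_graph R P"
    using assms(1,2) by (rule pair_graph_prime_ideal_graph)
  have PR: "P \<subseteq> carrier R"
    by (rule a_subset)
  have finP: "finite P"
    using PR assms(2) by (rule finite_subset)
  have card_R: "card (carrier R) = m * q"
    using card_carrier_eq_card_ideal_times_card_quotient assms by simp
  interpret Q: domain "R Quot P"
    by (rule quotient_is_domain)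
  have "finite (carrier (R Quot P))"
    using assms(2) by (auto simp: FactRing_def A_RCOSETS_def')
  then have "primepow q"
    using Q.finite_domain_primepow_order assms(5) by simp
  moreover have "digraph_iso (with_proj (prime_ideal_graph R P))
    (with_proj (graph_join (complete_graph (card (P - {\<zero>\<^bsub>R\<^esub>})))
      (edgeless_graph (card (carrier R - P)))))"
  proof (rule complete_join_edgeless_iso)
    have split: "P - {\<zero>\<^bsub>R\<^esub>} \<union> (carrier R - P) = carrier R - {\<zero>\<^bsub>R\<^esub>}"
      using PR additive_subgroup.zero_closed[OF additive_subgroup_axioms] by auto
    then show "pverts (prime_ideal_graph R P) = P - {\<zero>\<^bsub>R\<^esub>} \<union> (carrier R - P)"
      by (simp add: prime_ideal_graph_def)
    show "parcs (prime_ideal_graph R P) =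
      {(x, y). x \<in> P - {\<zero>\<^bsub>R\<^esub>} \<union> (carrier R - P) \<and> y \<in> P - {\<zero>\<^bsub>R\<^esub>} \<union> (carrier R - P)
        \<and> x \<noteq> y \<and> (x \<in> P - {\<zero>\<^bsub>R\<^esub>} \<or> y \<in> P - {\<zero>\<^bsub>R\<^esub>})}"
      unfolding split parcs_prime_ideal_graph by auto
  qed (use finP assms(2) \<Gamma>.pair_wf_digraph_axioms in auto)
  moreover have "card (P - {\<zero>\<^bsub>R\<^esub>}) = m - 1"
    using assms(4) additive_subgroup.zero_closed[OF additive_subgroup_axioms] by simp
  moreover have "card (carrier R - P) = m * (q - 1)"
    using card_Diff_subset[OF finP PR] card_R assms(4) by (simp add: diff_mult_distrib2)
  ultimately show ?thesis
    using card_R assms(4,5) by simp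
qed

end
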